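(* Let $(A,\cdot_A)$ be a commutative associative algebra. There is a one-to-one correspondence between the space of equivalence classes of pre-Lie infinitesimal deformations of $A$ and the second cohomology group $H^2_{\mathrm{reg}}(A,A)$.
   Context: All vector spaces are finite dimensional over an algebraically closed field $\mathbb{K}$ of characteristic $0$. A pre-Lie algebra is a vector space (or, for deformations, a $\mathbb{K}[[\hbar]]/(\hbar^2)$-module) with a bilinear product $\ast$ such that $(x\ast y)\ast z-x\ast(y\ast z)=(y\ast x)\ast z-y\ast(x\ast z)$ for all $x,y,z$. Every associative algebra is a pre-Lie algebra. A pre-Lie infinitesimal deformation of a commutative associative algebra $(A,\cdot_A)$, denoted $(A,\mu_1)$, is a bilinear map $\mu_1:A\times A\to A$ such that the $\mathbb{K}[[\hbar]]/(\hbar^2)$-bilinear product on $A[[\hbar]]/(\hbar^2)$ determined by $x\cdot_\hbar y=x\cdot_A y+\hbar\mu_1(x,y)$ for $x,y\in A$ is a pre-Lie algebra product. Two pre-Lie infinitesimal deformations $A_\hbar=(A,\mu_1)$ and $A'_\hbar=(A,\mu_1')$ are equivalent if there is a linear map $\varphi:A\to A$ such that $\mathrm{Id}+\hbar\varphi:A_\hbar\to A'_\hbar$ is a homomorphism of pre-Lie algebras modulo $\hbar^2$. Cohomology of a pre-Lie algebra $(\mathfrak{g},\ast)$ in the regular representation: let $[x,y]=x\ast y-y\ast x$ and $C^n(\mathfrak{g},\mathfrak{g})=\mathrm{Hom}(\wedge^{n-1}\mathfrak{g}\otimes\mathfrak{g},\mathfrak{g})$ for $n\ge1$, with coboundary $\mathrm{d}^{\mathrm{reg}}:C^n(\mathfrak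 g,\mathfrak g)\to C^{n+1}(\mathfrak g,\mathfrak g)$, $$\begin{aligned}\mathrm{d}^{\mathrm{reg}}\phi(x_1,\dots,x_{n+1})=&\sum_{i=1}^n(-1)^{i+1}x_i\ast\phi(x_1,\dots,\hat{x_i},\dots,x_{n+1})+\sum_{i=1}^n(-1)^{i+1}\phi(x_1,\dots,\hat{x_i},\dots,x_n,x_i)\ast x_{n+1}\\&-\sum_{i=1}^n(-1)^{i+1}\phi(x_1,\dots,\hat{x_i},\dots,x_n,x_i\ast x_{n+1})+\sum_{1\le i<j\le n}(-1)^{i+j}\phi([x_i,x_j],x_1,\dots,\hat{x_i},\dots,\hat{x_j},\dots,x_{n+1}).\end{aligned}$$ $H^n_{\mathrm{reg}}(\mathfrak{g},\mathfrak{g})$ is the $n$-th cohomology group of this complex. Here it is applied to $(\mathfrak{g},\ast)=(A,\cdot_A)$ viewed as a pre-Lie algebra. *)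

theory Defs
  imports
    "HOL-Library.Product_Plus"
    "HOL-Computational_Algebra.Polynomial"
begin

section \<open>Commutative associative algebras and pre-Lie algebras\<close>

locale nonassoc_algebra = module scale
  for scale :: "'r::comm_ring_1 \<Rightarrow> 'a::ab_group_add \<Rightarrow> 'a" +
  fixes mul :: "'a \<Rightarrow> 'a \<Rightarrow> 'a"
  assumes mult_left_hom: "module_hom scale scale (\<lambda>x. mul x y)"
    and mult_right_hom: "module_hom scale scale (\<lambda>y. mul x y)"

locale pre_lie_algebra = nonassoc_algebra scale mul
  for scale :: "'r::comm_ring_1 \<Rightarrow> 'a::ab_group_add \<Rightarrow> 'a" and mul +
  assumes pre_lie: "mul (mul x y) z - mul x (mul y z) = mul (mul y x) z - mul y (mul x z)"

locale comm_assoc_algebra = nonassoc_algebra scale mul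
  for scale :: "'r::comm_ring_1 \<Rightarrow> 'a::ab_group_add \<Rightarrow> 'a" and mul +
  assumes assoc: "mul (mul x y) z = mul x (mul y z)"
    and comm: "mul x y = mul y x"

sublocale comm_assoc_algebra \<subseteq> pre_lie_algebra
  by unfold_locales (simp add: assoc)

definition nonassoc_algebra_hom ::
  "('r::comm_ring_1 \<Rightarrow> 'a::ab_group_add \<Rightarrow> 'a) \<Rightarrow> ('a \<Rightarrow> 'a \<Rightarrow> 'a) \<Rightarrow> ('a \<Rightarrow> 'a \<Rightarrow> 'a) \<Rightarrow> ('a \<Rightarrow> 'a) \<Rightarrow> bool"
  where "nonassoc_algebra_hom scale mul mul' f \<longleftrightarrow>
    module_hom scale scale f \<and> (\<forall>x y. f (mul x y) = mul' (f x) (f y))"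


section \<open>The ring \<open>K[[\<hbar>]]/(\<hbar>\<^sup>2)\<close> and the module \<open>A[[\<hbar>]]/(\<hbar>\<^sup>2)\<close>\<close>

text \<open>\<open>Dual a b\<close> is the class of \<open>a + b \<hbar>\<close> in \<open>K[[\<hbar>]]/(\<hbar>\<^sup>2)\<close>.\<close>

datatype 'k dual_number = Dual (dual_fst: 'k) (dual_snd: 'k)

instantiation dual_number :: (comm_ring_1) comm_ring_1
begin

definition "0 = Dual 0 0"
definition "1 = Dual 1 0"
definition "a + b = Dual (dual_fst a + dual_fst b) (dual_snd a + dual_snd b)"
definition "a - b = Dual (dual_fst a - dual_fst b) (dual_snd a - dual_snd b)"
definition "- a = Dual (- dual_fst a) (- dual_snd a)"
definition "a * b = Dual (dual_fst a * dual_fst b) (dual_fst a * dual_snd b + dual_snd a * dual_fst b)"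

instance
  by standard
    (simp_all add: zero_dual_number_def one_dual_number_def plus_dual_number_def
      minus_dual_number_def uminus_dual_number_def times_dual_number_def algebra_simps)

end

text \<open>A pair \<open>(x\<^sub>0, x\<^sub>1)\<close> stands for \<open>x\<^sub>0 + \<hbar> x\<^sub>1\<close> in \<open>A[[\<hbar>]]/(\<hbar>\<^sup>2)\<close>.\<close>

definition hbar_scale ::
  "('k \<Rightarrow> 'a::ab_group_add \<Rightarrow> 'a) \<Rightarrow> 'k dual_number \<Rightarrow> 'a \<times> 'a \<Rightarrow> 'a \<times> 'a"
  where "hbar_scale scale c u =
    (scale (dual_fst c) (fst u), scale (dual_fst c) (snd u) + scale (dual_snd c) (fst u))"

lemma module_hbar_scale:
  assumes "module scale"
  shows "module (hbar_scale scale)"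
proof -
  interpret module scale by fact
  show ?thesis
    by unfold_locales
      (simp_all add: hbar_scale_def plus_dual_number_def times_dual_number_def
        one_dual_number_def scale_right_distrib scale_left_distrib algebra_simps)
qed

definition hbar_mult ::
  "('a::ab_group_add \<Rightarrow> 'a \<Rightarrow> 'a) \<Rightarrow> ('a \<Rightarrow> 'a \<Rightarrow> 'a) \<Rightarrow> 'a \<times> 'a \<Rightarrow> 'a \<times> 'a \<Rightarrow> 'a \<times> 'a"
  where "hbar_mult mul \<mu> u v =
    (mul (fst u) (fst v), mul (fst u) (snd v) + mul (snd u) (fst v) + \<mu> (fst u) (fst v))"

text \<open>\<^const>\<open>hbar_mult\<close> is the unique \<open>K[[\<hbar>]]/(\<hbar>\<^sup>2)\<close>-bilinear product that restricts to
  \<open>x \<cdot> y + \<hbar> \<mu> x y\<close> on \<open>A\<close>.\<close>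

lemma nonassoc_algebra_hbar_mult:
  assumes "nonassoc_algebra scale mul" and "nonassoc_algebra scale \<mu>"
  shows "nonassoc_algebra (hbar_scale scale) (hbar_mult mul \<mu>)"
proof -
  interpret A: nonassoc_algebra scale mul by fact
  interpret M: nonassoc_algebra scale \<mu> by fact
  interpret H: module "hbar_scale scale" by (rule module_hbar_scale) unfold_locales
  note [simp] = module_hom.add[OF A.mult_left_hom] module_hom.add[OF A.mult_right_hom]
    module_hom.scale[OF A.mult_left_hom] module_hom.scale[OF A.mult_right_hom]
    module_hom.add[OF M.mult_left_hom] module_hom.add[OF M.mult_right_hom]
    module_hom.scale[OF M.mult_left_hom] module_hom.scale[OF M.mult_right_hom]
  show ?thesis
    by unfold_locales
      (simp_all add: hbar_mult_def hbar_scale_def A.scale_right_distrib algebra_simps)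
qed

lemma hbar_mult_unique:
  fixes scale :: "'k::comm_ring_1 \<Rightarrow> 'a::ab_group_add \<Rightarrow> 'a"
  assumes "nonassoc_algebra scale mul" and "nonassoc_algebra scale \<mu>"
    and "nonassoc_algebra (hbar_scale scale) m"
    and "\<And>x y. m (x, 0) (y, 0) = (mul x y, \<mu> x y)"
  shows "m = hbar_mult mul \<mu>"
proof (intro ext)
  fix u v :: "'a \<times> 'a"
  interpret A: nonassoc_algebra scale mul by fact
  interpret P: nonassoc_algebra "hbar_scale scale" m by fact
  note lin = module_hom.add[OF P.mult_left_hom] module_hom.add[OF P.mult_right_hom]
    module_hom.scale[OF P.mult_left_hom] module_hom.scale[OF P.mult_right_hom]
  have split: "w = (fst w, 0) + hbar_scale scale (Dual 0 1) (snd w, 0)" for w :: "'a \<times> 'a"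
    by (simp add: hbar_scale_def)
  have "m u v = m ((fst u, 0) + hbar_scale scale (Dual 0 1) (snd u, 0))
      ((fst v, 0) + hbar_scale scale (Dual 0 1) (snd v, 0))"
    by (subst (1) split[of u], subst (1) split[of v]) (rule refl)
  also have "\<dots> = hbar_mult mul \<mu> u v"
    unfolding lin assms(4) by (simp add: hbar_scale_def hbar_mult_def algebra_simps)
  finally show "m u v = hbar_mult mul \<mu> u v" .
qed


section \<open>Pre-Lie infinitesimal deformations\<close>

definition pre_lie_deformations ::
  "('k::comm_ring_1 \<Rightarrow> 'a::ab_group_add \<Rightarrow> 'a) \<Rightarrow> ('a \<Rightarrow> 'a \<Rightarrow> 'a) \<Rightarrow> ('a \<Rightarrow> 'a \<Rightarrow> 'a) set"
  where "pre_lie_deformations scale mul =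
    {\<mu>. nonassoc_algebra scale \<mu> \<and> pre_lie_algebra (hbar_scale scale) (hbar_mult mul \<mu>)}"

text \<open>The \<open>K[[\<hbar>]]/(\<hbar>\<^sup>2)\<close>-linear map \<open>Id + \<hbar> \<phi>\<close>.\<close>

definition id_plus_hbar :: "('a::ab_group_add \<Rightarrow> 'a) \<Rightarrow> 'a \<times> 'a \<Rightarrow> 'a \<times> 'a"
  where "id_plus_hbar \<phi> u = (fst u, snd u + \<phi> (fst u))"

definition deformation_equivalence ::
  "('k::comm_ring_1 \<Rightarrow> 'a::ab_group_add \<Rightarrow> 'a) \<Rightarrow> ('a \<Rightarrow> 'a \<Rightarrow> 'a)
    \<Rightarrow> (('a \<Rightarrow> 'a \<Rightarrow> 'a) \<times> ('a \<Rightarrow> 'a \<Rightarrow> 'a)) set"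
  where "deformation_equivalence scale mul =
    {(\<mu>, \<mu>'). \<mu> \<in> pre_lie_deformations scale mul \<and> \<mu>' \<in> pre_lie_deformations scale mul \<and>
      (\<exists>\<phi>. module_hom scale scale \<phi> \<and>
        nonassoc_algebra_hom (hbar_scale scale) (hbar_mult mul \<mu>) (hbar_mult mul \<mu>')
          (id_plus_hbar \<phi>))}"

lemma module_hom_id_plus_hbar:
  assumes "module_hom scale scale \<phi>"
  shows "module_hom (hbar_scale scale) (hbar_scale scale) (id_plus_hbar \<phi>)"
proof -
  interpret h: module_hom scale scale \<phi> by fact
  interpret H: module "hbar_scale scale" by (rule module_hbar_scale) unfold_locales
  show ?thesis
    by unfold_locales
      (simp_all add: id_plus_hbar_def hbar_scale_def h.add h.scale h.m1.scale_right_distrib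
        algebra_simps)
qed

lemma equiv_deformation_equivalence:
  fixes scale :: "'k::comm_ring_1 \<Rightarrow> 'a::ab_group_add \<Rightarrow> 'a"
  assumes "module scale"
  shows "equiv (pre_lie_deformations scale mul) (deformation_equivalence scale mul)"
proof -
  interpret A: module scale by fact
  interpret AA: module_pair scale scale by unfold_locales
  have inv: "id_plus_hbar (\<lambda>x. - \<phi> x) (id_plus_hbar \<phi> u) = u"
      "id_plus_hbar \<phi> (id_plus_hbar (\<lambda>x. - \<phi> x) u) = u" for \<phi> :: "'a \<Rightarrow> 'a" and u
    by (simp_all add: id_plus_hbar_def)
  have comp: "id_plus_hbar (\<lambda>x. \<phi> x + \<psi> x) u = id_plus_hbar \<psi> (id_plus_hbar \<phi> u)"
    for \<phi> \<psi> :: "'a \<Rightarrow> 'a" and u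
    by (simp add: id_plus_hbar_def algebra_simps)
  have id0: "id_plus_hbar (\<lambda>x. 0) u = u" for u :: "'a \<times> 'a"
    by (simp add: id_plus_hbar_def)
  have refl: "(\<mu>, \<mu>) \<in> deformation_equivalence scale mul"
    if "\<mu> \<in> pre_lie_deformations scale mul" for \<mu>
  proof -
    have "module_hom scale scale (\<lambda>x. 0)" by (rule AA.module_hom_zero)
    moreover from this have "nonassoc_algebra_hom (hbar_scale scale) (hbar_mult mul \<mu>)
        (hbar_mult mul \<mu>) (id_plus_hbar (\<lambda>x. 0))"
      by (simp add: nonassoc_algebra_hom_def module_hom_id_plus_hbar id0)
    ultimately show ?thesis
      using that unfolding deformation_equivalence_def by blast
  qed
  have sym: "(\<mu>', \<mu>) \<in> deformation_equivalence scale mul"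
    if eq: "(\<mu>, \<mu>') \<in> deformation_equivalence scale mul" for \<mu> \<mu>'
  proof -
    from eq obtain \<phi> where \<phi>: "module_hom scale scale \<phi>"
      and h: "\<And>u v. id_plus_hbar \<phi> (hbar_mult mul \<mu> u v)
        = hbar_mult mul \<mu>' (id_plus_hbar \<phi> u) (id_plus_hbar \<phi> v)"
      and d: "\<mu> \<in> pre_lie_deformations scale mul" "\<mu>' \<in> pre_lie_deformations scale mul"
      by (auto simp: deformation_equivalence_def nonassoc_algebra_hom_def)
    have n: "module_hom scale scale (\<lambda>x. - \<phi> x)"
      using \<phi> by (rule AA.module_hom_neg)
    have "id_plus_hbar (\<lambda>x. - \<phi> x) (hbar_mult mul \<mu>' u v)
        = hbar_mult mul \<mu> (id_plus_hbar (\<lambda>x. - \<phi> x) u) (id_plus_hbar (\<lambda>x. - \<phi> x) v)" for u v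
      using h[of "id_plus_hbar (\<lambda>x. - \<phi> x) u" "id_plus_hbar (\<lambda>x. - \<phi> x) v"]
      by (metis inv)
    with n have "nonassoc_algebra_hom (hbar_scale scale) (hbar_mult mul \<mu>')
        (hbar_mult mul \<mu>) (id_plus_hbar (\<lambda>x. - \<phi> x))"
      by (simp add: nonassoc_algebra_hom_def module_hom_id_plus_hbar)
    with n d show ?thesis
      unfolding deformation_equivalence_def by blast
  qed
  have trans: "(\<mu>, \<mu>'') \<in> deformation_equivalence scale mul"
    if eq: "(\<mu>, \<mu>') \<in> deformation_equivalence scale mul"
      "(\<mu>', \<mu>'') \<in> deformation_equivalence scale mul" for \<mu> \<mu>' \<mu>''
  proof -
    from eq obtain \<phi> \<psi> where \<phi>: "module_hom scale scale \<phi>" "module_hom scale scale \<psi>"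
      and h: "\<And>u v. id_plus_hbar \<phi> (hbar_mult mul \<mu> u v)
        = hbar_mult mul \<mu>' (id_plus_hbar \<phi> u) (id_plus_hbar \<phi> v)"
      "\<And>u v. id_plus_hbar \<psi> (hbar_mult mul \<mu>' u v)
        = hbar_mult mul \<mu>'' (id_plus_hbar \<psi> u) (id_plus_hbar \<psi> v)"
      and d: "\<mu> \<in> pre_lie_deformations scale mul" "\<mu>'' \<in> pre_lie_deformations scale mul"
      by (auto simp: deformation_equivalence_def nonassoc_algebra_hom_def)
    have n: "module_hom scale scale (\<lambda>x. \<phi> x + \<psi> x)"
      using \<phi> by (rule AA.module_hom_add)
    then have "nonassoc_algebra_hom (hbar_scale scale) (hbar_mult mul \<mu>)
        (hbar_mult mul \<mu>'') (id_plus_hbar (\<lambda>x. \<phi> x + \<psi> x))"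
      by (simp add: nonassoc_algebra_hom_def module_hom_id_plus_hbar comp h)
    with n d show ?thesis
      unfolding deformation_equivalence_def by blast
  qed
  show ?thesis
  proof (rule equivI)
    show "deformation_equivalence scale mul
        \<subseteq> pre_lie_deformations scale mul \<times> pre_lie_deformations scale mul"
      by (auto simp: deformation_equivalence_def)
    show "refl_on (pre_lie_deformations scale mul) (deformation_equivalence scale mul)"
      using refl by (auto simp: refl_on_def)
    show "sym (deformation_equivalence scale mul)"
      using sym by (auto simp: sym_def)
    show "trans (deformation_equivalence scale mul)"
      using trans by (auto simp: trans_def)
  qed
qed


section \<open>Cohomology of a pre-Lie algebra in the regular representation\<close>

text \<open>An element of \<open>Hom (\<Lambda>\<^sup>n\<^sup>-\<^sup>1 g \<otimes> g, g)\<close> is given by the corresponding \<open>n\<close>-linear map that is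
  alternating in its first \<open>n - 1\<close> arguments. The arguments form a list of length \<open>n\<close>; the value on
  lists of any other length is fixed to be \<open>0\<close>, so that cochains are equal iff they are equal as
  multilinear maps. List positions start at \<open>0\<close>, so the argument \<open>x\<^sub>i\<close> is at position \<open>i - 1\<close>.\<close>

definition cochains ::
  "('k::comm_ring_1 \<Rightarrow> 'a::ab_group_add \<Rightarrow> 'a) \<Rightarrow> nat \<Rightarrow> ('a list \<Rightarrow> 'a) set"
  where "cochains scale n = {f.
    (\<forall>xs. length xs \<noteq> n \<longrightarrow> f xs = 0) \<and>
    (\<forall>xs i. length xs = n \<and> i < n \<longrightarrow> module_hom scale scale (\<lambda>x. f (xs[i := x]))) \<and>
    (\<forall>xs i j. length xs = n \<and> i < j \<and> j < n - 1 \<and> xs ! i = xs ! j \<longrightarrow> f xs = 0)}"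

definition omit :: "nat \<Rightarrow> 'a list \<Rightarrow> 'a list"
  where "omit i xs = take i xs @ drop (Suc i) xs"

text \<open>Shifting \<open>i\<close> and \<open>j\<close> to list positions turns the signs \<open>(-1)\<^sup>i\<^sup>+\<^sup>1\<close> and \<open>(-1)\<^sup>i\<^sup>+\<^sup>j\<close> of the
  usual formula into \<open>(-1)\<^sup>i\<close> and \<open>(-1)\<^sup>i\<^sup>+\<^sup>j\<close>. Here \<open>last xs\<close> is \<open>x\<^sub>n\<^sub>+\<^sub>1\<close> and \<open>butlast xs\<close> is
  \<open>x\<^sub>1, \<dots>, x\<^sub>n\<close>.\<close>

definition d_reg ::
  "('k::comm_ring_1 \<Rightarrow> 'a::ab_group_add \<Rightarrow> 'a) \<Rightarrow> ('a \<Rightarrow> 'a \<Rightarrow> 'a) \<Rightarrow> nat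
    \<Rightarrow> ('a list \<Rightarrow> 'a) \<Rightarrow> 'a list \<Rightarrow> 'a"
  where "d_reg scale mul n f xs =
    (if length xs = Suc n then
      (\<Sum>i<n. scale ((-1) ^ i) (mul (xs ! i) (f (omit i xs))))
      + (\<Sum>i<n. scale ((-1) ^ i) (mul (f (omit i (butlast xs) @ [xs ! i])) (last xs)))
      - (\<Sum>i<n. scale ((-1) ^ i) (f (omit i (butlast xs) @ [mul (xs ! i) (last xs)])))
      + (\<Sum>j<n. \<Sum>i<j. scale ((-1) ^ (i + j))
          (f ((mul (xs ! i) (xs ! j) - mul (xs ! j) (xs ! i)) # omit i (omit j xs))))
    else 0)"

definition cocycles ::
  "('k::comm_ring_1 \<Rightarrow> 'a::ab_group_add \<Rightarrow> 'a) \<Rightarrow> ('a \<Rightarrow> 'a \<Rightarrow> 'a) \<Rightarrow> nat \<Rightarrow> ('a list \<Rightarrow> 'a) set"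
  where "cocycles scale mul n = {f \<in> cochains scale n. d_reg scale mul n f = (\<lambda>xs. 0)}"

text \<open>The complex starts in degree \<open>1\<close>, where the only coboundary is \<open>0\<close>.\<close>

definition coboundaries ::
  "('k::comm_ring_1 \<Rightarrow> 'a::ab_group_add \<Rightarrow> 'a) \<Rightarrow> ('a \<Rightarrow> 'a \<Rightarrow> 'a) \<Rightarrow> nat \<Rightarrow> ('a list \<Rightarrow> 'a) set"
  where "coboundaries scale mul n =
    (if n \<le> 1 then {\<lambda>xs. 0} else d_reg scale mul (n - 1) ` cochains scale (n - 1))"

definition cohomologous ::
  "('k::comm_ring_1 \<Rightarrow> 'a::ab_group_add \<Rightarrow> 'a) \<Rightarrow> ('a \<Rightarrow> 'a \<Rightarrow> 'a) \<Rightarrow> nat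
    \<Rightarrow> (('a list \<Rightarrow> 'a) \<times> ('a list \<Rightarrow> 'a)) set"
  where "cohomologous scale mul n =
    {(f, g). f \<in> cocycles scale mul n \<and> g \<in> cocycles scale mul n \<and>
      (\<lambda>xs. f xs - g xs) \<in> coboundaries scale mul n}"

definition cohomology ::
  "('k::comm_ring_1 \<Rightarrow> 'a::ab_group_add \<Rightarrow> 'a) \<Rightarrow> ('a \<Rightarrow> 'a \<Rightarrow> 'a) \<Rightarrow> nat
    \<Rightarrow> ('a list \<Rightarrow> 'a) set set"
  where "cohomology scale mul n = cocycles scale mul n // cohomologous scale mul n"

definition bilinear_cochain :: "('a \<Rightarrow> 'a \<Rightarrow> 'a::zero) \<Rightarrow> 'a list \<Rightarrow> 'a"
  where "bilinear_cochain \<mu> xs = (if length xs = 2 then \<mu> (xs ! 0) (xs ! 1) else 0)"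

end

theory Submission
  imports Defs
begin

text \<open>The \<open>\<hbar>\<close>-part of the pre-Lie identity for \<open>x \<cdot> y + \<hbar> \<mu> x y\<close> is the cocycle equation for \<open>\<mu>\<close>:
  the terms \<open>\<mu> (x \<cdot> y) z\<close> and \<open>\<mu> (y \<cdot> x) z\<close> cancel, and so does the commutator term of the
  coboundary, because \<open>A\<close> is commutative. Likewise, \<open>Id + \<hbar> \<phi>\<close> is a homomorphism from the
  deformation \<open>\<mu>\<close> to \<open>\<mu>'\<close> iff \<open>\<mu> - \<mu>'\<close> is the coboundary of \<open>\<phi>\<close>. So \<open>\<mu> \<mapsto>\<close> (\<open>\<mu>\<close> as a cochain) is a
  bijection onto the cocycles that carries one equivalence relation to the other.\<close>

text \<open>The induced map sends a class to its image set, so there is no choice of representative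
  to justify. Injectivity is inherited from the bijection between \<open>Pow A\<close> and
  \<open>Pow B\<close>.\<close>

lemma bij_betw_quotient_image:
  assumes f: "bij_betw f A B"
    and R: "R \<subseteq> A \<times> A" and S: "S \<subseteq> B \<times> B"
    and iff: "\<And>x y. x \<in> A \<Longrightarrow> y \<in> A \<Longrightarrow> (x, y) \<in> R \<longleftrightarrow> (f x, f y) \<in> S"
  shows "bij_betw ((`) f) (A // R) (B // S)"
    and "\<And>x. x \<in> A \<Longrightarrow> f ` (R `` {x}) = S `` {f x}"
proof -
  show cls: "f ` (R `` {x}) = S `` {f x}" if "x \<in> A" for x
  proof
    show "f ` (R `` {x}) \<subseteq> S `` {f x}"
      using R iff by blast
    show "S `` {f x} \<subseteq> f ` (R `` {x})"
    proof
      fix b assume b: "b \<in> S `` {f x}"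
      with S obtain y where "y \<in> A" "b = f y"
        using bij_betw_imp_surj_on[OF f] by blast
      with b iff[OF that] show "b \<in> f ` (R `` {x})" by blast
    qed
  qed
  have "(`) f ` (A // R) = (\<lambda>x. S `` {f x}) ` A"
    unfolding quotient_def using cls by auto
  also have "\<dots> = B // S"
    unfolding quotient_def bij_betw_imp_surj_on[OF f, symmetric] by blast
  finally have image: "(`) f ` (A // R) = B // S" .
  have "A // R \<subseteq> Pow A"
    using R by (auto simp: quotient_def)
  with bij_betw_Pow[OF f] show "bij_betw ((`) f) (A // R) (B // S)"
    using image by (rule bij_betw_subset)
qed

lemma length_2_conv: "length xs = 2 \<longleftrightarrow> (\<exists>x y. xs = [x, y])"
  by (auto simp: numeral_2_eq_2 length_Suc_conv)

lemma length_3_conv: "length xs = 3 \<longleftrightarrow> (\<exists>x y z. xs = [x, y, z])"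
  by (auto simp: numeral_3_eq_3 length_Suc_conv)

context module
begin

lemma cochains_1_iff:
  "f \<in> cochains scale 1 \<longleftrightarrow>
    (\<exists>\<phi>. module_hom scale scale \<phi> \<and> f = (\<lambda>xs. if length xs = 1 then \<phi> (hd xs) else 0))"
proof
  assume f: "f \<in> cochains scale 1"
  \<comment> \<open>The entry 0 is a placeholder that the update overwrites:
    \<open>[0][0 := x]\<close> is \<open>[x]\<close>.\<close>
  then have "module_hom scale scale (\<lambda>x. f ([0][0 := x]))"
    unfolding cochains_def mem_Collect_eq by (metis One_nat_def length_Cons less_one list.size(3))
  moreover have "f = (\<lambda>xs. if length xs = 1 then f [hd xs] else 0)"
  proof
    fix xs show "f xs = (if length xs = 1 then f [hd xs] else 0)"
      using f by (auto simp: cochains_def length_Suc_conv)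
  qed
  ultimately show "\<exists>\<phi>. module_hom scale scale \<phi> \<and>
      f = (\<lambda>xs. if length xs = 1 then \<phi> (hd xs) else 0)"
    by auto
qed (auto simp: cochains_def length_Suc_conv)

text \<open>In degree 2 only one argument is subject to alternation, so that condition is vacuous
  and bilinearity alone remains.\<close>

lemma bilinear_cochain_in_cochains_iff:
  "bilinear_cochain \<mu> \<in> cochains scale 2 \<longleftrightarrow> nonassoc_algebra scale \<mu>"
proof
  assume b: "bilinear_cochain \<mu> \<in> cochains scale 2"
  have "module_hom scale scale (\<lambda>t. bilinear_cochain \<mu> ([x, y][i := t]))" if "i < 2" for x y i
    using b that unfolding cochains_def mem_Collect_eq
    by (metis One_nat_def length_Cons list.size(3) numeral_2_eq_2)
  \<comment> \<open>Updating position 0 gives linearity on the left, where the old entry 0 is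
    discarded; updating position 1 gives linearity on the right.\<close>
  from this[of 0 0] this[of 1] show "nonassoc_algebra scale \<mu>"
    by (auto simp: bilinear_cochain_def intro!: nonassoc_algebra.intro module_axioms
        nonassoc_algebra_axioms.intro)
next
  assume "nonassoc_algebra scale \<mu>"
  then interpret M: nonassoc_algebra scale \<mu> .
  show "bilinear_cochain \<mu> \<in> cochains scale 2"
    by (auto simp: cochains_def bilinear_cochain_def length_2_conv less_2_cases_iff
        intro: M.mult_left_hom M.mult_right_hom)
qed

end

lemma inj_bilinear_cochain: "inj bilinear_cochain"
proof (rule injI, intro ext)
  fix \<mu> \<nu> :: "'a::zero \<Rightarrow> 'a \<Rightarrow> 'a" and x y
  assume "bilinear_cochain \<mu> = bilinear_cochain \<nu>"
  then have "bilinear_cochain \<mu> [x, y] = bilinear_cochain \<nu> [x, y]" by simp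
  then show "\<mu> x y = \<nu> x y" by (simp add: bilinear_cochain_def)
qed

lemma cochain_2_eq_bilinear_cochain:
  assumes "f \<in> cochains scale 2"
  shows "f = bilinear_cochain (\<lambda>x y. f [x, y])"
proof
  fix xs show "f xs = bilinear_cochain (\<lambda>x y. f [x, y]) xs"
    using assms by (auto simp: cochains_def bilinear_cochain_def length_2_conv)
qed

context comm_assoc_algebra
begin

text \<open>The commutator sum is empty in degree 1. What is left measures how far
  \<open>\<phi>\<close> is from being a derivation.\<close>

lemma d_reg_1:
  "d_reg scale mul 1 (\<lambda>xs. if length xs = 1 then \<phi> (hd xs) else 0)
    = bilinear_cochain (\<lambda>x y. mul x (\<phi> y) + mul (\<phi> x) y - \<phi> (mul x y))"
proof
  fix xs
  show "d_reg scale mul 1 (\<lambda>xs. if length xs = 1 then \<phi> (hd xs) else 0) xs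
    = bilinear_cochain (\<lambda>x y. mul x (\<phi> y) + mul (\<phi> x) y - \<phi> (mul x y)) xs"
  proof (cases "length xs = 2")
    case True
    then obtain x y where "xs = [x, y]" by (auto simp: length_2_conv)
    then show ?thesis by (simp add: d_reg_def bilinear_cochain_def omit_def)
  qed (simp add: d_reg_def bilinear_cochain_def)
qed

lemma d_reg_2_bilinear_cochain:
  assumes "nonassoc_algebra scale \<mu>"
  shows "d_reg scale mul 2 (bilinear_cochain \<mu>) [x, y, z] =
    mul x (\<mu> y z) - mul y (\<mu> x z) + (mul (\<mu> y x) z - mul (\<mu> x y) z)
      - (\<mu> y (mul x z) - \<mu> x (mul y z))"
proof -
  interpret M: nonassoc_algebra scale \<mu> by fact
  \<comment> \<open>This removes the commutator term, whose first argument
    \<open>mul x y - mul y x\<close> is 0 by commutativity.\<close>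
  have "\<mu> 0 z = 0" for z
    using module_hom.zero[OF M.mult_left_hom] .
  then show ?thesis
    by (simp add: d_reg_def bilinear_cochain_def omit_def numeral_2_eq_2 comm[of y x])
qed

lemma pre_lie_hbar_mult_iff:
  assumes "nonassoc_algebra scale \<mu>"
  shows "pre_lie_algebra (hbar_scale scale) (hbar_mult mul \<mu>) \<longleftrightarrow>
    d_reg scale mul 2 (bilinear_cochain \<mu>) = (\<lambda>xs. 0)"
proof -
  interpret M: nonassoc_algebra scale \<mu> by fact
  interpret H: nonassoc_algebra "hbar_scale scale" "hbar_mult mul \<mu>"
    by (rule nonassoc_algebra_hbar_mult) unfold_locales
  let ?m = "hbar_mult mul \<mu>"
  have add: "mul (x + y) z = mul x z + mul y z" "mul x (y + z) = mul x y + mul x z" for x y z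
    using module_hom.add[OF mult_left_hom] module_hom.add[OF mult_right_hom] by auto
  have assoc_swap: "mul x (mul y z) = mul y (mul x z)" for x y z
    by (metis assoc comm)
  \<comment> \<open>The first component vanishes because \<open>mul\<close> is associative and
    commutative. For the same reason the terms with \<open>snd u\<close>, \<open>snd v\<close> or
    \<open>snd w\<close> cancel in the second, which leaves minus the coboundary at the first
    components.\<close>
  have diff: "?m (?m u v) w - ?m u (?m v w) - (?m (?m v u) w - ?m v (?m u w)) =
      (0, - d_reg scale mul 2 (bilinear_cochain \<mu>) [fst u, fst v, fst w])" for u v w
    unfolding d_reg_2_bilinear_cochain[OF assms]
    by (simp add: hbar_mult_def add assoc assoc_swap[of "fst v" "fst u"]
        assoc_swap[of "snd v" "fst u"] assoc_swap[of "fst v" "snd u"] comm[of "fst v" "fst u"])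
  \<comment> \<open>Off length 3 the coboundary has the default value 0, so its vanishing only has
    to be tested on triples.\<close>
  have "d_reg scale mul 2 (bilinear_cochain \<mu>) xs = 0" if "length xs \<noteq> 3" for xs
    using that by (simp add: d_reg_def)
  then have "d_reg scale mul 2 (bilinear_cochain \<mu>) = (\<lambda>xs. 0) \<longleftrightarrow>
      (\<forall>x y z. d_reg scale mul 2 (bilinear_cochain \<mu>) [x, y, z] = 0)"
    by (metis length_3_conv)
  also have "\<dots> \<longleftrightarrow> (\<forall>u v w. ?m (?m u v) w - ?m u (?m v w) = ?m (?m v u) w - ?m v (?m u w))"
    unfolding right_minus_eq[symmetric, of "?m (?m _ _) _ - _"] diff
    by (auto simp: zero_prod_def)
  also have "\<dots> \<longleftrightarrow> pre_lie_algebra (hbar_scale scale) ?m"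
    by (auto intro!: pre_lie_algebra.intro pre_lie_algebra_axioms.intro H.nonassoc_algebra_axioms
        dest: pre_lie_algebra.pre_lie)
  finally show ?thesis by simp
qed

lemma bij_betw_deformations_cocycles:
  "bij_betw bilinear_cochain (pre_lie_deformations scale mul) (cocycles scale mul 2)"
  unfolding bij_betw_def
proof
  show "inj_on bilinear_cochain (pre_lie_deformations scale mul)"
    using inj_bilinear_cochain by (rule inj_on_subset) simp
  have "bilinear_cochain \<mu> \<in> cocycles scale mul 2 \<longleftrightarrow> \<mu> \<in> pre_lie_deformations scale mul" for \<mu>
    by (auto simp: cocycles_def pre_lie_deformations_def bilinear_cochain_in_cochains_iff
        pre_lie_hbar_mult_iff)
  moreover have "f \<in> range bilinear_cochain" if "f \<in> cocycles scale mul 2" for f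
    using that cochain_2_eq_bilinear_cochain[of f scale] by (auto simp: cocycles_def)
  ultimately show "bilinear_cochain ` pre_lie_deformations scale mul = cocycles scale mul 2"
    by blast
qed

text \<open>Modulo \<open>\<hbar>\<close> the map is the identity, so only the
  \<open>\<hbar>\<close>-parts have to be compared; the terms with \<open>snd u\<close> and
  \<open>snd v\<close> occur on both sides and cancel.\<close>

lemma hbar_hom_iff:
  assumes "module_hom scale scale \<phi>"
  shows "nonassoc_algebra_hom (hbar_scale scale) (hbar_mult mul \<mu>) (hbar_mult mul \<mu>')
      (id_plus_hbar \<phi>) \<longleftrightarrow>
    (\<lambda>x y. \<mu> x y - \<mu>' x y) = (\<lambda>x y. mul x (\<phi> y) + mul (\<phi> x) y - \<phi> (mul x y))"
proof -
  have add: "mul (x + y) z = mul x z + mul y z" "mul x (y + z) = mul x y + mul x z" for x y z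
    using module_hom.add[OF mult_left_hom] module_hom.add[OF mult_right_hom] by auto
  have "id_plus_hbar \<phi> (hbar_mult mul \<mu> u v) =
      hbar_mult mul \<mu>' (id_plus_hbar \<phi> u) (id_plus_hbar \<phi> v) \<longleftrightarrow>
    \<mu> (fst u) (fst v) - \<mu>' (fst u) (fst v) =
      mul (fst u) (\<phi> (fst v)) + mul (\<phi> (fst u)) (fst v) - \<phi> (mul (fst u) (fst v))" for u v
    by (auto simp: id_plus_hbar_def hbar_mult_def add algebra_simps)
  then show ?thesis
    using module_hom_id_plus_hbar[OF assms]
    by (auto simp: nonassoc_algebra_hom_def fun_eq_iff)
qed

text \<open>Both relations ask for a linear \<open>\<phi>\<close> with the same formula for
  \<open>\<mu> - \<mu>'\<close>; injectivity of \<open>bilinear_cochain\<close> moves the equation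
  between bilinear maps and cochains.\<close>

lemma deformation_equivalence_iff_cohomologous:
  assumes "\<mu> \<in> pre_lie_deformations scale mul" and "\<mu>' \<in> pre_lie_deformations scale mul"
  shows "(\<mu>, \<mu>') \<in> deformation_equivalence scale mul \<longleftrightarrow>
    (bilinear_cochain \<mu>, bilinear_cochain \<mu>') \<in> cohomologous scale mul 2"
proof -
  let ?d = "\<lambda>\<phi> x y. mul x (\<phi> y) + mul (\<phi> x) y - \<phi> (mul x y)"
  have diff: "(\<lambda>xs. bilinear_cochain \<mu> xs - bilinear_cochain \<mu>' xs) =
      bilinear_cochain (\<lambda>x y. \<mu> x y - \<mu>' x y)"
    by (auto simp: bilinear_cochain_def)
  have "d_reg scale mul 1 ` cochains scale 1 =
      {bilinear_cochain (?d \<phi>) |\<phi>. module_hom scale scale \<phi>}"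
  proof -
    have "cochains scale 1 = (\<lambda>\<phi> xs. if length xs = 1 then \<phi> (hd xs) else 0) `
        {\<phi>. module_hom scale scale \<phi>}"
      using cochains_1_iff by blast
    then show ?thesis
      by (simp only: image_image d_reg_1 setcompr_eq_image)
  qed
  then have "coboundaries scale mul 2 =
      {bilinear_cochain (?d \<phi>) |\<phi>. module_hom scale scale \<phi>}"
    by (simp add: coboundaries_def)
  then show ?thesis
    using assms bij_betwE[OF bij_betw_deformations_cocycles]
    by (auto simp: deformation_equivalence_def cohomologous_def diff hbar_hom_iff
        inj_eq[OF inj_bilinear_cochain])
qed

end

theorem theorem3p22:
  fixes scale :: "'k::{alg_closed_field, field_char_0} \<Rightarrow> 'a::ab_group_add \<Rightarrow> 'a"
    and Basis :: "'a set"
    and mul :: "'a \<Rightarrow> 'a \<Rightarrow> 'a"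
  assumes "finite_dimensional_vector_space scale Basis"
    and "comm_assoc_algebra scale mul"
  shows "\<exists>\<Phi>. bij_betw \<Phi>
        (pre_lie_deformations scale mul // deformation_equivalence scale mul)
        (cohomology scale mul 2)
      \<and> (\<forall>\<mu> \<in> pre_lie_deformations scale mul.
          \<Phi> (deformation_equivalence scale mul `` {\<mu>})
            = cohomologous scale mul 2 `` {bilinear_cochain \<mu>})"
proof -
  interpret comm_assoc_algebra scale mul by fact
  have "deformation_equivalence scale mul
      \<subseteq> pre_lie_deformations scale mul \<times> pre_lie_deformations scale mul"
    by (auto simp: deformation_equivalence_def)
  moreover have "cohomologous scale mul 2 \<subseteq> cocycles scale mul 2 \<times> cocycles scale mul 2"
    by (auto simp: cohomologous_def)
  ultimately show ?thesis
    \<comment> \<open>The witness for \<open>\<Phi>\<close> is taking images under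
      \<open>bilinear_cochain\<close>; the second conclusion of the lemma gives its value on each
      class.\<close>
    using bij_betw_quotient_image[OF bij_betw_deformations_cocycles _ _
        deformation_equivalence_iff_cohomologous]
    unfolding cohomology_def by blast
qed

end
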